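(* Let $\mathcal M$ be an associative monoid with unit element $I$, complete under a distance $d$ satisfying $$d(xz,yz)\le |z|\,d(x,y),\qquad d(zx,zy)\le |z|\,d(x,y)$$ for all $x,y,z\in\mathcal M$, where $z\mapsto|z|$ is a (real-valued) Lipschitz function on $\mathcal M$ with $|I|=1$. Let $V$ be a strong control function on $[0,T[$, with associated $\theta>2$ and $\overline V(t)=\sum_{n\ge0}\theta^nV(t\,2^{-n})$. Let $\mu(a,b)$ be a continuous $\mathcal M$-valued function defined for $0\le a\le b<T$ such that $\mu(a,a)=I$ for every $a$ and $$d(\mu(a,b),\mu(a,c)\mu(c,b))\le V(b-a)$$ for all $0\le a\le c\le b<T$. Then there exists a unique multiplicative $\mathcal M$-valued function $u(a,b)$, defined for $0\le a\le b<T$, such that $$d(\mu(a,b),u(a,b))\le \mathrm{Cst}\,\overline V(b-a)\qquad\text{for every } a\le b,$$ where $\mathrm{Cst}$ denotes a constant.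
   Context: A control function on $[0,T[$ is a function $V$ defined on $[0,T[$ that is non-decreasing, with $V(0)=0$ and $\sum_{n\ge 1}V(1/n)<\infty$ (the sum being over those $n$ with $1/n<T$). A strong control function is a control function $V$ for which there exists $\theta>2$ such that $\overline V(t)=\sum_{n\ge0}\theta^nV(t\,2^{-n})<\infty$ for every $t\in[0,T[$. An $\mathcal M$-valued function $u(a,b)$ is called multiplicative if $u(a,b)=u(a,c)u(c,b)$ for all $a\le c\le b$.
   Formalization: Cst may depend on S: for each S<T one constant serves all 0≤a≤b≤S, since a single constant on all of [0,T[ can fail to exist when μ is unbounded near T; uniqueness holds among all multiplicative functions satisfying this local bound. *)

theory Defs
  imports "HOL-Analysis.Analysis"
begin

(* T is an extended real, so that the interval [0,T[ may be the whole half-line. *)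

definition control_domain :: "ereal \<Rightarrow> real set" where
  "control_domain T = {t. 0 \<le> t \<and> ereal t < T}"

definition simplex_domain :: "ereal \<Rightarrow> (real \<times> real) set" where
  "simplex_domain T = {(a, b). 0 \<le> a \<and> a \<le> b \<and> ereal b < T}"

definition control_function :: "ereal \<Rightarrow> (real \<Rightarrow> real) \<Rightarrow> bool" where
  "control_function T V \<longleftrightarrow>
     mono_on (control_domain T) V \<and> V 0 = 0 \<and>
     (\<lambda>n::nat. V (1 / real n)) summable_on {n. n \<ge> 1 \<and> ereal (1 / real n) < T}"

definition strong_exponent :: "ereal \<Rightarrow> (real \<Rightarrow> real) \<Rightarrow> real \<Rightarrow> bool" where
  "strong_exponent T V \<theta> \<longleftrightarrow>
     \<theta> > 2 \<and> (\<forall>t\<in>control_domain T. summable (\<lambda>n. \<theta> ^ n * V (t / 2 ^ n)))"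

definition strong_control_function :: "ereal \<Rightarrow> (real \<Rightarrow> real) \<Rightarrow> bool" where
  "strong_control_function T V \<longleftrightarrow> control_function T V \<and> (\<exists>\<theta>. strong_exponent T V \<theta>)"

definition Vbar :: "real \<Rightarrow> (real \<Rightarrow> real) \<Rightarrow> real \<Rightarrow> real" where
  "Vbar \<theta> V t = (\<Sum>n. \<theta> ^ n * V (t / 2 ^ n))"

definition multiplicative :: "ereal \<Rightarrow> (real \<Rightarrow> real \<Rightarrow> 'a::times) \<Rightarrow> bool" where
  "multiplicative T u \<longleftrightarrow>
     (\<forall>a c b. 0 \<le> a \<and> a \<le> c \<and> c \<le> b \<and> ereal b < T \<longrightarrow> u a b = u a c * u c b)"

(* The constant is uniform on each compact subinterval [0,S] of [0,T[, and may depend on S.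
   A single constant on all of [0,T[ need not exist for the multiplicative function
   associated with mu: nothing bounds mu near T.  Example: T = 1, V t = t^2, 2 < theta < 4,
   real matrices [x, y; 0, 1] with the operator norm, g t = 1 / (1 - t), and mu(a,b) with
     x = ((1 - a) / (1 - b))^4   and   y = (1 - a)^4 / 4 * max 0 (g b - g a - 1).
   Then d(mu(a,b), mu(a,c) mu(c,b)) vanishes if g b - g a \<le> 1; otherwise b - a > (1 - a)^2 / 2
   and it is at most (1 - a)^4 / 4 \<le> V(b - a).  The multiplicative function is
   u(a,b) = [x, 0; 0, 1], but d(mu(0,b), u(0,b)) tends to infinity as b tends to 1, whereas
   Vbar stays bounded. *)

definition close_to :: "ereal \<Rightarrow> (real \<Rightarrow> real) \<Rightarrow>
    (real \<Rightarrow> real \<Rightarrow> 'a::metric_space) \<Rightarrow> (real \<Rightarrow> real \<Rightarrow> 'a) \<Rightarrow> bool" where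
  "close_to T W \<mu> u \<longleftrightarrow>
     (\<forall>S::real. ereal S < T \<longrightarrow>
        (\<exists>Cst::real. \<forall>a b. 0 \<le> a \<and> a \<le> b \<and> b \<le> S \<longrightarrow> dist (\<mu> a b) (u a b) \<le> Cst * W (b - a)))"

end

theory Submission
  imports Defs
begin

text \<open>
  Fix \<open>S < T\<close> and work on \<open>[0,S]\<close>. The function \<open>u(a,b)\<close> is the limit of the products of \<open>\<mu>\<close> along
  fine partitions of \<open>[a,b]\<close>, and three estimates make this work.

  On short intervals, every product along a partition of \<open>[a,b]\<close> is within a constant times
  \<open>Vbar(b - a)\<close> of \<open>\<mu>(a,b)\<close> (\<open>ex_short\<close>). Cutting out the cell that contains the midpoint leaves two
  partitions of intervals of at most half the length; each half contributes its error multiplied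
  by the norms of the other factors, which are at most \<open>\<kappa> = sqrt (\<theta> / 2)\<close>. So the error \<open>E\<close> satisfies
  \<open>E(t) \<le> (1 + \<kappa>) V(t) + 2 \<kappa>\<^sup>2 E(t/2)\<close>, and since \<open>2 \<kappa>\<^sup>2 = \<theta>\<close> and \<open>Vbar(t) = V(t) + \<theta> Vbar(t/2)\<close>
  the bound reproduces itself. This is where a ratio \<open>\<theta>\<close> larger than 2 is consumed: it leaves room
  for norms slightly larger than 1.

  On long intervals the norm gives no direct control, because it is not assumed to be
  submultiplicative. Instead one bounds the Lipschitz constants of left and right
  multiplication by the product, which do multiply (\<open>mult_bound_chain\<close>). Replacing the cells of a
  partition one after the other then shows that refining a partition into \<open>2\<^sup>n\<close> cells of length at
  most \<open>S/2\<^sup>n\<close> changes the product by \<open>O(2\<^sup>n Vbar(S/2\<^sup>n))\<close> (\<open>dist_refinement\<close>), which tends to 0.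

  The partitions used are the dyadic grids of \<open>[0,S]\<close> itself, clamped to \<open>[a,b]\<close>. They are nested,
  so the products converge; and the grids of \<open>[a,c]\<close> and \<open>[c,b]\<close> together refine the grid of \<open>[a,b]\<close>,
  so the limit is multiplicative at every \<open>c\<close>, not only at dyadic points (\<open>ex_limit\<close>). The estimate
  on short intervals passes to the limit and spreads to all of \<open>[0,S]\<close> by doubling the length.

  For uniqueness, two solutions are within \<open>2 C Vbar(t)\<close> of each other on intervals of length \<open>t\<close>;
  halving \<open>n\<close> times improves this to \<open>2 C \<theta>\<^sup>n Vbar(t/2\<^sup>n)\<close>, the tail of a convergent series.
  Uniqueness on each \<open>[0,S]\<close> also makes the solutions for different \<open>S\<close> fit together.
\<close>

section \<open>Products along partitions\<close>

fun mprod :: "(real \<Rightarrow> real \<Rightarrow> 'a::monoid_mult) \<Rightarrow> real list \<Rightarrow> 'a" where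
  "mprod \<mu> (x # y # xs) = \<mu> x y * mprod \<mu> (y # xs)"
| "mprod \<mu> [x] = 1"
| "mprod \<mu> [] = 1"

lemma mprod_append:
  "xs \<noteq> [] \<Longrightarrow> ys \<noteq> [] \<Longrightarrow>
    mprod \<mu> (xs @ ys) = mprod \<mu> xs * \<mu> (last xs) (hd ys) * mprod \<mu> ys"
proof (induction \<mu> xs rule: mprod.induct)
  case (2 \<mu> x)
  then show ?case by (cases ys) auto
qed (auto simp: mult.assoc)

lemma mprod_split: "mprod \<mu> (xs @ y # ys) = mprod \<mu> (xs @ [y]) * mprod \<mu> (y # ys)"
  by (cases "xs = []") (simp_all add: mprod_append)

text \<open>Partitions are lists in which points may be repeated. Clamping a grid to a subinterval then
  yields a partition, and the degenerate cells are harmless because \<open>\<mu> a a = 1\<close>.\<close>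

definition chain :: "real \<Rightarrow> real \<Rightarrow> real \<Rightarrow> real list \<Rightarrow> bool" where
  "chain h a b xs \<longleftrightarrow> xs \<noteq> [] \<and> hd xs = a \<and> last xs = b \<and>
     successively (\<lambda>x y. x \<le> y \<and> y - x \<le> h) xs"

lemma chain_append:
  assumes "xs \<noteq> []" "ys \<noteq> []"
  shows "chain h a b (xs @ ys) \<longleftrightarrow> chain h a (last xs) xs \<and> chain h (hd ys) b ys \<and>
           last xs \<le> hd ys \<and> hd ys - last xs \<le> h"
  using assms by (auto simp: chain_def successively_append_iff)

lemma chain_split: "chain h a b (xs @ y # ys) \<longleftrightarrow> chain h a y (xs @ [y]) \<and> chain h y b (y # ys)"
  by (cases "xs = []") (auto simp: chain_def successively_append_iff)

lemma chain_Cons_Cons: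
  "chain h a b (x # y # xs) \<longleftrightarrow> x = a \<and> a \<le> y \<and> y - a \<le> h \<and> chain h y b (y # xs)"
  by (auto simp: chain_def)

lemma chain_bounds: "chain h a b xs \<Longrightarrow> x \<in> set xs \<Longrightarrow> a \<le> x \<and> x \<le> b"
proof (induction xs arbitrary: a x)
  case Nil
  then show ?case by simp
next
  case (Cons y ys)
  show ?case
  proof (cases ys)
    case Nil
    with Cons.prems show ?thesis by (simp add: chain_def)
  next
    case (Cons z zs)
    then have *: "y = a" "a \<le> z" "chain h z b ys"
      using Cons.prems(1) by (auto simp: chain_Cons_Cons)
    from Cons.IH[OF *(3)] have "z \<le> x' \<and> x' \<le> b" if "x' \<in> set ys" for x'
      using that by blast
    moreover have "z \<in> set ys" by (simp add: Cons)
    ultimately show ?thesis using Cons.prems(2) * by fastforce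
  qed
qed

lemma chain_le: "chain h a b xs \<Longrightarrow> a \<le> b"
  using chain_bounds[of h a b xs b] by (auto simp: chain_def)

lemma chain_mono: "chain h a b xs \<Longrightarrow> h \<le> h' \<Longrightarrow> chain h' a b xs"
  unfolding chain_def by (auto elim!: successively_mono)

lemma chain_cut:
  assumes "chain h a b xs" "a \<le> m" "m < b"
  obtains ys zs where "xs = ys @ zs" "ys \<noteq> []" "zs \<noteq> []" "last ys \<le> m" "m < hd zs"
proof
  let ?ys = "takeWhile (\<lambda>x. x \<le> m) xs" and ?zs = "dropWhile (\<lambda>x. x \<le> m) xs"
  show "xs = ?ys @ ?zs" by simp
  from assms show ne: "?ys \<noteq> []" by (cases xs) (auto simp: chain_def)
  have "last xs \<in> set xs" "\<not> last xs \<le> m" using assms by (auto simp: chain_def)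
  then show ne': "?zs \<noteq> []" by auto
  show "last ?ys \<le> m" using last_in_set[OF ne] by (rule set_takeWhileD[THEN conjunct2])
  show "m < hd ?zs" using hd_dropWhile[OF ne'] by simp
qed

lemma mprod_const:
  assumes "chain h a a xs" "\<mu> a a = 1"
  shows "mprod \<mu> xs = 1"
  using assms(1)
proof (induction xs)
  case (Cons x xs)
  show ?case
  proof (cases xs)
    case (Cons y ys)
    with Cons.prems have "x = a" "a \<le> y" and c: "chain h y a (y # ys)"
      by (auto simp: chain_Cons_Cons)
    with chain_le[OF c] have "y = a" by simp
    with c Cons.IH \<open>x = a\<close> assms(2) Cons show ?thesis by simp
  qed simp
qed simp


section \<open>Sewing on a compact interval\<close>

text \<open>The Lipschitz constants of the two multiplications by \<open>z\<close> replace the norm of \<open>z\<close> on long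
  products: the norm is controlled near elements of known norm only, whereas these constants
  behave well under products.\<close>

definition mult_bound :: "real \<Rightarrow> 'a::{metric_space, monoid_mult} \<Rightarrow> bool" where
  "mult_bound K z \<longleftrightarrow>
     (\<forall>x y. dist (x * z) (y * z) \<le> K * dist x y \<and> dist (z * x) (z * y) \<le> K * dist x y)"

lemma mult_bound_one: "mult_bound 1 1"
  by (simp add: mult_bound_def)

lemma mult_bound_mono: "mult_bound K z \<Longrightarrow> K \<le> K' \<Longrightarrow> mult_bound K' z"
  unfolding mult_bound_def by (meson mult_right_mono order_trans zero_le_dist)

lemma mult_bound_mult:
  assumes "mult_bound K z" "mult_bound K' w" "0 \<le> K" "0 \<le> K'"
  shows "mult_bound (K * K') (z * w)"
proof -
  have "dist (x * (z * w)) (y * (z * w)) \<le> K * K' * dist x y" for x y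
  proof -
    have "dist ((x * z) * w) ((y * z) * w) \<le> K' * dist (x * z) (y * z)"
      using assms(2) by (simp add: mult_bound_def)
    also have "\<dots> \<le> K' * (K * dist x y)"
      using assms(1,4) by (intro mult_left_mono) (auto simp: mult_bound_def)
    finally show ?thesis by (simp add: mult_ac)
  qed
  moreover have "dist (z * w * x) (z * w * y) \<le> K * K' * dist x y" for x y
  proof -
    have "dist (z * (w * x)) (z * (w * y)) \<le> K * dist (w * x) (w * y)"
      using assms(1) by (simp add: mult_bound_def)
    also have "\<dots> \<le> K * (K' * dist x y)"
      using assms(2,3) by (intro mult_left_mono) (auto simp: mult_bound_def)
    finally show ?thesis by (simp add: mult_ac)
  qed
  ultimately show ?thesis by (simp add: mult_bound_def)
qed

text \<open>The problem restricted to \<open>[0,S]\<close>, where a single constant suffices.\<close>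

definition solves :: "real \<Rightarrow> (real \<Rightarrow> real) \<Rightarrow> (real \<Rightarrow> real \<Rightarrow> 'a::{metric_space, monoid_mult}) \<Rightarrow>
    (real \<Rightarrow> real \<Rightarrow> 'a) \<Rightarrow> bool" where
  "solves S W \<mu> u \<longleftrightarrow>
     (\<forall>a c b. 0 \<le> a \<and> a \<le> c \<and> c \<le> b \<and> b \<le> S \<longrightarrow> u a b = u a c * u c b) \<and>
     (\<exists>C. \<forall>a b. 0 \<le> a \<and> a \<le> b \<and> b \<le> S \<longrightarrow> dist (\<mu> a b) (u a b) \<le> C * W (b - a))"

lemma solves_mono: "solves S W \<mu> u \<Longrightarrow> S' \<le> S \<Longrightarrow> solves S' W \<mu> u"
  unfolding solves_def by (meson order_trans)

locale sewing =
  fixes S :: real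
    and V :: "real \<Rightarrow> real"
    and \<theta> :: real
    and N :: "'a :: {complete_space, monoid_mult} \<Rightarrow> real"
    and L :: real
    and \<mu> :: "real \<Rightarrow> real \<Rightarrow> 'a"
  assumes S_nonneg: "0 \<le> S"
    and N_bound: "mult_bound (N z) z"
    and N_lip: "L-lipschitz_on UNIV N"
    and N_one: "N 1 = 1"
    and V_mono: "mono_on {0..S} V"
    and V_zero: "V 0 = 0"
    and \<theta>: "\<theta> > 2"
    and V_sum: "\<And>t. t \<in> {0..S} \<Longrightarrow> summable (\<lambda>n. \<theta> ^ n * V (t / 2 ^ n))"
    and mu_cont: "continuous_on {(a, b). 0 \<le> a \<and> a \<le> b \<and> b \<le> S} (\<lambda>(a, b). \<mu> a b)"
    and mu_diag: "\<And>a. 0 \<le> a \<Longrightarrow> a \<le> S \<Longrightarrow> \<mu> a a = 1"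
    and mu_almost: "\<And>a c b. 0 \<le> a \<Longrightarrow> a \<le> c \<Longrightarrow> c \<le> b \<Longrightarrow> b \<le> S \<Longrightarrow>
           dist (\<mu> a b) (\<mu> a c * \<mu> c b) \<le> V (b - a)"
begin

abbreviation "W \<equiv> Vbar \<theta> V"

lemma L_nonneg: "0 \<le> L"
  using N_lip by (rule lipschitz_on_nonneg)

lemma N_le: "N y \<le> N x + L * dist x y"
  using lipschitz_onD[OF N_lip, of x y] by (auto simp: dist_real_def)

lemma dist_mult_right: "N z \<le> K \<Longrightarrow> dist (x * z) (y * z) \<le> K * dist x y"
  and dist_mult_left: "N z \<le> K \<Longrightarrow> dist (z * x) (z * y) \<le> K * dist x y"
  using mult_bound_mono[OF N_bound] by (auto simp: mult_bound_def)

lemma dist_mult: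
  assumes "N x \<le> K" "N y' \<le> K'"
  shows "dist (x * y) (x' * y') \<le> K * dist y y' + K' * dist x x'"
  using dist_triangle[of "x * y" "x' * y'" "x * y'"]
    dist_mult_left[OF assms(1), of y y'] dist_mult_right[OF assms(2), of x x'] by linarith

subsection \<open>The control function\<close>

lemma half_mem: "t \<in> {0..S} \<Longrightarrow> t / 2 ^ n \<in> {0..S}"
  using divide_left_mono[of 1 "2 ^ n" t] by auto

text \<open>\<open>\<theta>\<^sup>n Vbar(t/2\<^sup>n)\<close> is the tail, from index \<open>n\<close>, of the series that defines \<open>Vbar t\<close>. The functional
  equation of \<open>Vbar\<close> and its decay under halving both come from this.\<close>

lemma W_shift:
  assumes "t \<in> {0..S}"
  shows "\<theta> ^ n * W (t / 2 ^ n) = (\<Sum>k. \<theta> ^ (k + n) * V (t / 2 ^ (k + n)))"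
proof -
  have "\<theta> ^ n * W (t / 2 ^ n) = (\<Sum>k. \<theta> ^ n * (\<theta> ^ k * V (t / 2 ^ n / 2 ^ k)))"
    unfolding Vbar_def using half_mem[OF assms] by (intro suminf_mult[symmetric] V_sum)
  also have "\<dots> = (\<Sum>k. \<theta> ^ (k + n) * V (t / 2 ^ (k + n)))"
    by (simp add: power_add mult_ac)
  finally show ?thesis .
qed

lemma W_step:
  assumes "t \<in> {0..S}"
  shows "W t = V t + \<theta> * W (t / 2)"
  using W_shift[OF assms, of 1] suminf_split_head[OF V_sum[OF assms]]
  by (simp add: Vbar_def)

lemma W_tendsto:
  assumes "t \<in> {0..S}"
  shows "(\<lambda>n. \<theta> ^ n * W (t / 2 ^ n)) \<longlonglongrightarrow> 0"
  unfolding W_shift[OF assms] by (rule suminf_exist_split2[OF V_sum[OF assms]])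

lemma W_mono:
  assumes "s \<in> {0..S}" "t \<in> {0..S}" "s \<le> t"
  shows "W s \<le> W t"
  unfolding Vbar_def
proof (rule suminf_le[OF _ V_sum[OF assms(1)] V_sum[OF assms(2)]])
  fix n
  show "\<theta> ^ n * V (s / 2 ^ n) \<le> \<theta> ^ n * V (t / 2 ^ n)"
    using \<theta> assms half_mem[of s n] half_mem[of t n]
    by (intro mult_left_mono mono_onD[OF V_mono]) (auto simp: divide_right_mono)
qed

lemma W_zero: "W 0 = 0"
  by (simp add: Vbar_def V_zero)

lemma W_nonneg: "t \<in> {0..S} \<Longrightarrow> 0 \<le> W t"
  using W_mono[of 0 t] W_zero S_nonneg by simp

lemma V_le_W: "t \<in> {0..S} \<Longrightarrow> V t \<le> W t"
  using W_step[of t] W_nonneg[OF half_mem[of t 1]] \<theta> by simp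

lemma W_tendsto_weak:
  assumes "t \<in> {0..S}"
  shows "(\<lambda>n. 2 ^ n * W (t / 2 ^ n)) \<longlonglongrightarrow> 0"
proof -
  have nonneg: "0 \<le> W (t / 2 ^ n)" for n using W_nonneg[OF half_mem[OF assms]] .
  have "2 ^ n * W (t / 2 ^ n) \<le> \<theta> ^ n * W (t / 2 ^ n)" for n
    using power_mono[of 2 \<theta> n] \<theta> by (intro mult_right_mono[OF _ nonneg]) simp
  then show ?thesis
    using nonneg by (intro tendsto_sandwich[OF _ _ tendsto_const W_tendsto[OF assms]]
        always_eventually allI mult_nonneg_nonneg) auto
qed

lemma W_small:
  assumes "0 < \<epsilon>"
  obtains \<delta> where "0 < \<delta>" "\<And>t. t \<in> {0..S} \<Longrightarrow> t \<le> \<delta> \<Longrightarrow> W t \<le> \<epsilon>"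
proof (cases "S = 0")
  case True
  with assms W_zero that[of 1] show thesis by simp
next
  case False
  have S: "S \<in> {0..S}" using S_nonneg by simp
  have "\<forall>\<^sub>F n in sequentially. 2 ^ n * W (S / 2 ^ n) < \<epsilon>"
    using W_tendsto_weak[OF S] assms by (rule order_tendstoD)
  then obtain n where n: "2 ^ n * W (S / 2 ^ n) < \<epsilon>"
    by (auto simp: eventually_sequentially)
  have "1 * W (S / 2 ^ n) \<le> 2 ^ n * W (S / 2 ^ n)"
    using W_nonneg[OF half_mem[OF S]] by (intro mult_right_mono) auto
  with n have "W (S / 2 ^ n) \<le> \<epsilon>" by simp
  then have "W t \<le> \<epsilon>" if "t \<in> {0..S}" "t \<le> S / 2 ^ n" for t
    using W_mono[OF that(1) half_mem[OF S] that(2)] by simp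
  moreover have "0 < S / 2 ^ n" using False S_nonneg by simp
  ultimately show thesis using that by blast
qed

subsection \<open>Bounds for the approximate product\<close>

lemma compact_simplex: "compact {(a::real, b). 0 \<le> a \<and> a \<le> b \<and> b \<le> S}"
proof -
  have "{(a, b). 0 \<le> a \<and> a \<le> b \<and> b \<le> S} = ({0..S} \<times> {0..S}) \<inter> {p. fst p \<le> snd p}"
    by auto
  moreover have "closed {p::real \<times> real. fst p \<le> snd p}"
    by (intro closed_Collect_le continuous_intros)
  ultimately show ?thesis
    by (simp add: compact_Int_closed compact_Times)
qed

lemma mu_bounded:
  obtains B where "1 \<le> B" "\<And>a b. 0 \<le> a \<Longrightarrow> a \<le> b \<Longrightarrow> b \<le> S \<Longrightarrow> N (\<mu> a b) \<le> B"
proof -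
  let ?D = "{(a, b). 0 \<le> a \<and> a \<le> b \<and> b \<le> S}"
  have "bounded ((\<lambda>(a, b). \<mu> a b) ` ?D)"
    by (intro compact_imp_bounded compact_continuous_image mu_cont compact_simplex)
  then obtain R where R: "\<And>x. x \<in> (\<lambda>(a, b). \<mu> a b) ` ?D \<Longrightarrow> dist 1 x \<le> R"
    unfolding bounded_any_center[of _ 1] by blast
  have "N (\<mu> a b) \<le> max 1 (1 + L * R)" if "0 \<le> a" "a \<le> b" "b \<le> S" for a b
  proof -
    have "dist 1 (\<mu> a b) \<le> R" by (rule R) (use that in force)
    then have "L * dist 1 (\<mu> a b) \<le> L * R" using L_nonneg by (rule mult_left_mono)
    then show ?thesis using N_le[of "\<mu> a b" 1] N_one by simp
  qed
  then show thesis using that[of "max 1 (1 + L * R)"] by simp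
qed

lemma mu_short:
  assumes "0 < \<epsilon>"
  obtains \<delta> where "0 < \<delta>"
    "\<And>a b. 0 \<le> a \<Longrightarrow> a \<le> b \<Longrightarrow> b \<le> S \<Longrightarrow> b - a \<le> \<delta> \<Longrightarrow> N (\<mu> a b) \<le> 1 + \<epsilon>"
proof -
  let ?D = "{(a, b). 0 \<le> a \<and> a \<le> b \<and> b \<le> S}"
  have "uniformly_continuous_on ?D (\<lambda>(a, b). \<mu> a b)"
    by (intro compact_uniformly_continuous mu_cont compact_simplex)
  moreover have "0 < \<epsilon> / (L + 1)" using assms L_nonneg by simp
  ultimately obtain d where d: "0 < d" and
    close: "\<And>p q. p \<in> ?D \<Longrightarrow> q \<in> ?D \<Longrightarrow> dist q p < d \<Longrightarrow>
      dist ((\<lambda>(a, b). \<mu> a b) q) ((\<lambda>(a, b). \<mu> a b) p) < \<epsilon> / (L + 1)"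
    unfolding uniformly_continuous_on_def by meson
  have "N (\<mu> a b) \<le> 1 + \<epsilon>" if "0 \<le> a" "a \<le> b" "b \<le> S" "b - a \<le> d / 2" for a b
  proof -
    have "dist (\<mu> a a) (\<mu> a b) < \<epsilon> / (L + 1)"
      using close[of "(a, b)" "(a, a)"] that d by (simp add: dist_Pair_Pair dist_real_def)
    then have "dist 1 (\<mu> a b) \<le> \<epsilon> / (L + 1)"
      using mu_diag[of a] that by simp
    then have "L * dist 1 (\<mu> a b) \<le> L * (\<epsilon> / (L + 1))" using L_nonneg by (rule mult_left_mono)
    also have "\<dots> \<le> \<epsilon>" using L_nonneg assms by (simp add: field_simps)
    finally show ?thesis using N_le[of "\<mu> a b" 1] N_one by simp
  qed
  then show thesis using that[of "d / 2"] d by simp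
qed

text \<open>Near the diagonal \<open>\<mu>\<close> is close to the unit, by uniform continuity, and so is everything within
  \<open>C Vbar(b - a)\<close> of it. The bound turns closeness to \<open>\<mu>\<close> into the control of norms that products of
  the next size require.\<close>

lemma N_close:
  assumes "1 < r" "0 \<le> C"
  obtains \<delta> where "0 < \<delta>"
    "\<And>a b z. 0 \<le> a \<Longrightarrow> a \<le> b \<Longrightarrow> b \<le> S \<Longrightarrow> b - a \<le> \<delta> \<Longrightarrow> dist (\<mu> a b) z \<le> C * W (b - a) \<Longrightarrow> N z \<le> r"
proof -
  define \<eta> where "\<eta> = (r - 1) / 2"
  define \<epsilon> where "\<epsilon> = \<eta> / ((L + 1) * (C + 1))"
  have \<eta>: "0 < \<eta>" using assms by (simp add: \<eta>_def)
  have pos: "0 < (L + 1) * (C + 1)" using assms L_nonneg by simp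
  have \<epsilon>: "0 < \<epsilon>" "(L + 1) * (C + 1) * \<epsilon> = \<eta>"
    unfolding \<epsilon>_def using \<eta> pos by (auto intro!: nonzero_mult_div_cancel_left simp only: divide_pos_pos times_divide_eq_right)
  obtain \<delta>1 where \<delta>1: "0 < \<delta>1" and mu1:
    "\<And>a b. 0 \<le> a \<Longrightarrow> a \<le> b \<Longrightarrow> b \<le> S \<Longrightarrow> b - a \<le> \<delta>1 \<Longrightarrow> N (\<mu> a b) \<le> 1 + \<eta>"
    using mu_short[OF \<eta>] by blast
  obtain \<delta>2 where \<delta>2: "0 < \<delta>2" and W2: "\<And>t. t \<in> {0..S} \<Longrightarrow> t \<le> \<delta>2 \<Longrightarrow> W t \<le> \<epsilon>"
    using W_small[OF \<epsilon>(1)] by blast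
  have "N z \<le> r" if ab: "0 \<le> a" "a \<le> b" "b \<le> S" "b - a \<le> min \<delta>1 \<delta>2"
    and z: "dist (\<mu> a b) z \<le> C * W (b - a)" for a b z
  proof -
    have "L * dist (\<mu> a b) z \<le> L * (C * W (b - a))"
      using z L_nonneg by (rule mult_left_mono)
    also have "\<dots> \<le> L * (C * \<epsilon>)"
      using ab W2[of "b - a"] L_nonneg assms by (intro mult_left_mono) auto
    also have "\<dots> \<le> (L + 1) * ((C + 1) * \<epsilon>)"
      using assms \<epsilon>(1) L_nonneg by (intro mult_mono) auto
    also have "\<dots> = \<eta>" using \<epsilon>(2) by (simp only: mult.assoc)
    finally have "L * dist (\<mu> a b) z \<le> \<eta>" .
    moreover have "N (\<mu> a b) \<le> 1 + \<eta>" using ab by (intro mu1) auto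
    moreover have "1 + 2 * \<eta> = r" by (simp add: \<eta>_def field_simps)
    ultimately show ?thesis using N_le[of z "\<mu> a b"] by linarith
  qed
  then show thesis using that[of "min \<delta>1 \<delta>2"] \<delta>1 \<delta>2 by simp
qed

text \<open>The largest bound on the norms of the factors for which halving an interval costs a factor of at
  most \<open>\<theta>\<close>: two halves, each multiplied by two factors of norm at most \<open>\<kappa>\<close>.\<close>

definition "\<kappa> = sqrt (\<theta> / 2)"

lemma kappa: "1 < \<kappa>" "2 * (\<kappa> * \<kappa>) = \<theta>"
  using \<theta> by (auto simp: \<kappa>_def)

text \<open>Lengths below which products along partitions are controlled. The mesh \<open>h\<close> is arbitrary here,
  since a short interval has short cells only.\<close>

definition short :: "real \<Rightarrow> bool" where
  "short \<delta> \<longleftrightarrow> 0 < \<delta> \<and> (\<forall>a b h xs. 0 \<le> a \<and> b \<le> S \<and> b - a \<le> \<delta> \<and> chain h a b xs \<longrightarrow>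
     dist (\<mu> a b) (mprod \<mu> xs) \<le> (1 + \<kappa>) * W (b - a) \<and> N (\<mu> a b) \<le> \<kappa> \<and> N (mprod \<mu> xs) \<le> \<kappa>)"

text \<open>Induction on the number of points of the partition. The norm bound for a shorter product
  follows from the distance bound by \<open>N_close\<close>, so only distances need to be carried through the
  induction.\<close>

lemma ex_short: "\<exists>\<delta>. short \<delta>"
proof -
  obtain \<delta> where \<delta>: "0 < \<delta>" and N_near: "\<And>a b z. 0 \<le> a \<Longrightarrow> a \<le> b \<Longrightarrow> b \<le> S \<Longrightarrow>
      b - a \<le> \<delta> \<Longrightarrow> dist (\<mu> a b) z \<le> (1 + \<kappa>) * W (b - a) \<Longrightarrow> N z \<le> \<kappa>"
    using N_close[of \<kappa> "1 + \<kappa>"] kappa by auto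
  have mu_le: "N (\<mu> a b) \<le> \<kappa>" if "0 \<le> a" "a \<le> b" "b \<le> S" "b - a \<le> \<delta>" for a b
    using N_near[OF that, of "\<mu> a b"] W_nonneg[of "b - a"] kappa that by simp
  have main: "dist (\<mu> a b) (mprod \<mu> xs) \<le> (1 + \<kappa>) * W (b - a)"
    if "0 \<le> a" "b \<le> S" "b - a \<le> \<delta>" "chain h a b xs" for a b h xs
    using that
  proof (induction "length xs" arbitrary: a b xs rule: less_induct)
    case less
    have ab: "a \<le> b" using less.prems(4) by (rule chain_le)
    show ?case
    proof (cases "a = b")
      case True
      then show ?thesis
        using less.prems mu_diag[of a] mprod_const[of h a xs \<mu>] W_zero by simp
    next
      case False
      define t where "t = b - a"
      have t: "t \<in> {0..S}" using ab less.prems by (simp add: t_def)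
      obtain ys zs where xs: "xs = ys @ zs" and ne: "ys \<noteq> []" "zs \<noteq> []"
        and mid: "last ys \<le> a + t / 2" "a + t / 2 < hd zs"
        using chain_cut[OF less.prems(4), of "a + t / 2"] ab False
        by (auto simp: t_def field_simps)
      \<comment> \<open>\<open>[l,r]\<close> is the cell that contains the midpoint, so \<open>[a,l]\<close> and \<open>[r,b]\<close> have length at most \<open>t/2\<close>.\<close>
      define l r where "l = last ys" and "r = hd zs"
      have ys: "chain h a l ys" and zs: "chain h r b zs" and lr: "l \<le> r"
        using less.prems(4) ne by (auto simp: xs chain_append l_def r_def)
      have al: "a \<le> l" and rb: "r \<le> b" using chain_le ys zs by blast+
      have le: "l - a \<le> t / 2" "b - r \<le> t / 2" using mid by (auto simp: l_def r_def t_def field_simps)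
      have IHl: "dist (\<mu> a l) (mprod \<mu> ys) \<le> (1 + \<kappa>) * W (l - a)"
        using less.prems rb lr ne ys by (intro less.hyps) (auto simp: xs)
      have IHr: "dist (\<mu> r b) (mprod \<mu> zs) \<le> (1 + \<kappa>) * W (b - r)"
        using less.prems al lr ne zs by (intro less.hyps) (auto simp: xs)
      have Nys: "N (mprod \<mu> ys) \<le> \<kappa>"
        using less.prems al lr rb by (intro N_near[OF _ _ _ _ IHl]) auto
      have Nlr: "N (\<mu> l r) \<le> \<kappa>" and Nrb: "N (\<mu> r b) \<le> \<kappa>" and Nal: "N (\<mu> a l) \<le> \<kappa>"
        using less.prems al lr rb by (auto intro!: mu_le)
      have half: "t / 2 \<in> {0..S}" using half_mem[OF t, of 1] by simp
      have dl: "dist (\<mu> a l) (mprod \<mu> ys) \<le> (1 + \<kappa>) * W (t / 2)"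
      proof -
        have "W (l - a) \<le> W (t / 2)" using half al le by (intro W_mono) auto
        then show ?thesis using IHl kappa by (meson add_pos_pos less_imp_le less_trans mult_left_mono order_trans zero_less_one)
      qed
      have dr: "dist (\<mu> r b) (mprod \<mu> zs) \<le> (1 + \<kappa>) * W (t / 2)"
      proof -
        have "W (b - r) \<le> W (t / 2)" using half rb le by (intro W_mono) auto
        then show ?thesis using IHr kappa by (meson add_pos_pos less_imp_le less_trans mult_left_mono order_trans zero_less_one)
      qed
      have 1: "dist (\<mu> a b) (\<mu> a l * \<mu> l b) \<le> V t"
        unfolding t_def using less.prems al lr rb by (intro mu_almost) auto
      have 2: "dist (\<mu> a l * \<mu> l b) (\<mu> a l * (\<mu> l r * \<mu> r b)) \<le> \<kappa> * V t"
      proof -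
        have "dist (\<mu> l b) (\<mu> l r * \<mu> r b) \<le> V (b - l)"
          using less.prems al lr rb by (intro mu_almost) auto
        also have "\<dots> \<le> V t" using less.prems al lr rb t
          by (intro mono_onD[OF V_mono]) (auto simp: t_def)
        finally have "\<kappa> * dist (\<mu> l b) (\<mu> l r * \<mu> r b) \<le> \<kappa> * V t" using kappa by simp
        then show ?thesis using dist_mult_left[OF Nal, of "\<mu> l b" "\<mu> l r * \<mu> r b"] by linarith
      qed
      have 3: "dist (\<mu> a l * (\<mu> l r * \<mu> r b)) (mprod \<mu> ys * (\<mu> l r * \<mu> r b))
          \<le> \<kappa> * \<kappa> * ((1 + \<kappa>) * W (t / 2))"
      proof -
        have "mult_bound (\<kappa> * \<kappa>) (\<mu> l r * \<mu> r b)"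
          using kappa Nlr Nrb by (intro mult_bound_mult mult_bound_mono[OF N_bound]) auto
        then have "dist (\<mu> a l * (\<mu> l r * \<mu> r b)) (mprod \<mu> ys * (\<mu> l r * \<mu> r b))
            \<le> \<kappa> * \<kappa> * dist (\<mu> a l) (mprod \<mu> ys)"
          by (simp add: mult_bound_def)
        also have "\<dots> \<le> \<kappa> * \<kappa> * ((1 + \<kappa>) * W (t / 2))"
          using kappa by (intro mult_left_mono dl) auto
        finally show ?thesis .
      qed
      have 4: "dist (mprod \<mu> ys * (\<mu> l r * \<mu> r b)) (mprod \<mu> xs)
          \<le> \<kappa> * \<kappa> * ((1 + \<kappa>) * W (t / 2))"
      proof -
        have "mult_bound (\<kappa> * \<kappa>) (mprod \<mu> ys * \<mu> l r)"
          using kappa Nlr Nys by (intro mult_bound_mult mult_bound_mono[OF N_bound]) auto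
        then have "dist ((mprod \<mu> ys * \<mu> l r) * \<mu> r b) ((mprod \<mu> ys * \<mu> l r) * mprod \<mu> zs)
            \<le> \<kappa> * \<kappa> * dist (\<mu> r b) (mprod \<mu> zs)"
          by (simp add: mult_bound_def)
        also have "\<dots> \<le> \<kappa> * \<kappa> * ((1 + \<kappa>) * W (t / 2))"
          using kappa by (intro mult_left_mono dr) auto
        finally show ?thesis using ne by (simp add: xs mprod_append mult.assoc l_def r_def)
      qed
      have "dist (\<mu> a b) (mprod \<mu> xs) \<le>
          dist (\<mu> a b) (\<mu> a l * \<mu> l b) + dist (\<mu> a l * \<mu> l b) (\<mu> a l * (\<mu> l r * \<mu> r b)) +
          dist (\<mu> a l * (\<mu> l r * \<mu> r b)) (mprod \<mu> ys * (\<mu> l r * \<mu> r b)) +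
          dist (mprod \<mu> ys * (\<mu> l r * \<mu> r b)) (mprod \<mu> xs)"
        using dist_triangle[of "\<mu> a b" "mprod \<mu> xs" "\<mu> a l * \<mu> l b"]
          dist_triangle[of "\<mu> a l * \<mu> l b" "mprod \<mu> xs" "\<mu> a l * (\<mu> l r * \<mu> r b)"]
          dist_triangle[of "\<mu> a l * (\<mu> l r * \<mu> r b)" "mprod \<mu> xs" "mprod \<mu> ys * (\<mu> l r * \<mu> r b)"]
        by linarith
      also have "\<dots> \<le> (1 + \<kappa>) * (V t + 2 * (\<kappa> * \<kappa>) * W (t / 2))"
        using 1 2 3 4 by (simp add: algebra_simps)
      also have "\<dots> = (1 + \<kappa>) * W t" by (simp add: kappa W_step[OF t])
      finally show ?thesis by (simp add: t_def)
    qed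
  qed
  have "short \<delta>" unfolding short_def
  proof (intro conjI \<delta> allI impI)
    fix a b h xs assume *: "0 \<le> a \<and> b \<le> S \<and> b - a \<le> \<delta> \<and> chain h a b xs"
    then have ab: "a \<le> b" using chain_le by blast
    show d: "dist (\<mu> a b) (mprod \<mu> xs) \<le> (1 + \<kappa>) * W (b - a)" using * main by blast
    show "N (\<mu> a b) \<le> \<kappa>" "N (mprod \<mu> xs) \<le> \<kappa>"
      using * ab mu_le N_near[OF _ _ _ _ d] by blast+
  qed
  then show ?thesis ..
qed

lemma short_pos: "short \<delta> \<Longrightarrow> 0 < \<delta>"
  by (simp add: short_def)

lemma short_mprod:
  assumes "short \<delta>" "0 \<le> a" "b \<le> S" "b - a \<le> \<delta>" "chain h a b xs"
  shows "dist (\<mu> a b) (mprod \<mu> xs) \<le> (1 + \<kappa>) * W (b - a)" "mult_bound \<kappa> (mprod \<mu> xs)"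
  using assms mult_bound_mono[OF N_bound] unfolding short_def by blast+

lemma short_mu:
  assumes "short \<delta>" "0 \<le> a" "a \<le> b" "b \<le> S" "b - a \<le> \<delta>"
  shows "N (\<mu> a b) \<le> \<kappa>"
proof -
  have "chain \<delta> a b [a, b]" using assms by (simp add: chain_def)
  then show ?thesis using assms unfolding short_def by blast
qed

text \<open>A partition of mesh \<open>\<delta>\<close> is cut greedily into an initial part of length at most \<open>\<delta>\<close>, one cell,
  and a rest that starts more than \<open>\<delta>\<close> further on. At most about \<open>S/\<delta>\<close> cuts are needed, whatever the
  number of points, so one constant serves all partitions.\<close>

lemma mult_bound_chain:
  assumes "short \<delta>"
  obtains K where "1 \<le> K"
    "\<And>a b xs. 0 \<le> a \<Longrightarrow> b \<le> S \<Longrightarrow> chain \<delta> a b xs \<Longrightarrow> mult_bound K (mprod \<mu> xs)"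
proof -
  note \<delta> = short_pos[OF assms]
  have main: "mult_bound (\<kappa> ^ (2 * k)) (mprod \<mu> xs)"
    if "0 \<le> a" "b \<le> S" "chain \<delta> a b xs" "b - a \<le> real k * \<delta>" for k a b xs
    using that
  proof (induction k arbitrary: a xs)
    case 0
    then have "b = a" using chain_le[of \<delta> a b xs] by simp
    with 0 show ?case using mprod_const[of \<delta> a xs \<mu>] mu_diag[of a] mult_bound_one by simp
  next
    case (Suc k)
    show ?case
    proof (cases "b - a \<le> \<delta>")
      case True
      have "\<kappa> ^ 1 \<le> \<kappa> ^ (2 * Suc k)" using kappa by (intro power_increasing) auto
      then show ?thesis
        using mult_bound_mono[OF short_mprod(2)[OF assms Suc.prems(1,2) True Suc.prems(3)]] by simp
    next
      case False
      then obtain ys zs where xs: "xs = ys @ zs" and ne: "ys \<noteq> []" "zs \<noteq> []"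
        and mid: "last ys \<le> a + \<delta>" "a + \<delta> < hd zs"
        using chain_cut[OF Suc.prems(3), of "a + \<delta>"] \<delta> by auto
      define l r where "l = last ys" and "r = hd zs"
      have ys: "chain \<delta> a l ys" and zs: "chain \<delta> r b zs" and lr: "l \<le> r" "r - l \<le> \<delta>"
        using Suc.prems(3) ne by (auto simp: xs chain_append l_def r_def)
      have al: "a \<le> l" and rb: "r \<le> b" using chain_le ys zs by blast+
      have "mult_bound \<kappa> (mprod \<mu> ys)"
        using mid lr rb Suc.prems by (intro short_mprod(2)[OF assms _ _ _ ys]) (auto simp: l_def)
      moreover have "mult_bound \<kappa> (\<mu> l r)"
        using al lr rb Suc.prems by (intro mult_bound_mono[OF N_bound] short_mu[OF assms]) auto
      moreover have "mult_bound (\<kappa> ^ (2 * k)) (mprod \<mu> zs)"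
        using al lr rb Suc.prems mid by (intro Suc.IH[OF _ _ zs]) (auto simp: r_def algebra_simps)
      ultimately have "mult_bound (\<kappa> * \<kappa> * \<kappa> ^ (2 * k)) (mprod \<mu> ys * \<mu> l r * mprod \<mu> zs)"
        using kappa by (intro mult_bound_mult) auto
      then show ?thesis using ne by (simp add: xs mprod_append l_def r_def mult_ac)
    qed
  qed
  define k where "k = nat \<lceil>S / \<delta>\<rceil>"
  have k: "S \<le> real k * \<delta>"
    using \<delta> real_nat_ceiling_ge[of "S / \<delta>"] by (simp add: k_def pos_divide_le_eq)
  show thesis
  proof (rule that[of "\<kappa> ^ (2 * k)"])
    show "1 \<le> \<kappa> ^ (2 * k)" using kappa by (intro one_le_power) auto
    show "mult_bound (\<kappa> ^ (2 * k)) (mprod \<mu> xs)" if "0 \<le> a" "b \<le> S" "chain \<delta> a b xs" for a b xs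
      using that k by (intro main) auto
  qed
qed

text \<open>The cells of \<open>P\<close> are replaced from left to right by the parts of \<open>Q\<close> inside them. The factor along
  \<open>R\<close> stands for the part that is already replaced: it is itself a product along a partition, hence
  bounded by \<open>K\<close>, so the constants do not accumulate over the cells.\<close>

lemma dist_refinement:
  assumes "short \<delta>" and h: "h \<le> \<delta>" "h \<in> {0..S}" and "1 \<le> K"
    and K: "\<And>a b xs. 0 \<le> a \<Longrightarrow> b \<le> S \<Longrightarrow> chain \<delta> a b xs \<Longrightarrow> mult_bound K (mprod \<mu> xs)"
    and "0 \<le> a'" "b \<le> S" "chain \<delta> a' a R" "chain h a b P" "chain h a b Q" "set P \<subseteq> set Q"
  shows "dist (mprod \<mu> R * mprod \<mu> P) (mprod \<mu> R * mprod \<mu> Q)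
    \<le> real (length P - 1) * (K * K * ((1 + \<kappa>) * W h))"
  using assms(8-)
proof (induction P arbitrary: a R Q)
  case Nil
  then show ?case by (simp add: chain_def)
next
  case (Cons x P)
  have a: "0 \<le> a" using chain_le[OF Cons.prems(1)] assms(6) by simp
  show ?case
  proof (cases P)
    case Nil
    with Cons.prems(2) have "x = a" "b = a" by (auto simp: chain_def)
    then show ?thesis using Nil Cons.prems(3) mprod_const[of h a Q \<mu>] mu_diag[of a] a assms(7) by simp
  next
    case P: (Cons y P')
    have x: "x = a" and ay: "a \<le> y" "y - a \<le> h" and tail: "chain h y b P"
      using Cons.prems(2) by (auto simp: P chain_Cons_Cons)
    have yb: "y \<le> b" using tail by (rule chain_le)
    have "y \<in> set Q" using Cons.prems(4) by (simp add: P)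
    then obtain Q1 Q2 where Q: "Q = Q1 @ y # Q2" by (meson split_list)
    define QL QR where "QL = Q1 @ [y]" and "QR = y # Q2"
    have QL: "chain h a y QL" and QR: "chain h y b QR"
      using Cons.prems(3) unfolding Q QL_def QR_def chain_split[of h a b] by auto
    have prodQ: "mprod \<mu> Q = mprod \<mu> QL * mprod \<mu> QR"
      by (simp add: Q QL_def QR_def mprod_split[symmetric])
    have sub: "set P \<subseteq> set QR"
    proof
      fix z assume z: "z \<in> set P"
      then have "z \<in> set QL \<or> z \<in> set QR"
        using Cons.prems(4) by (auto simp: Q QL_def QR_def)
      then show "z \<in> set QR"
        using chain_bounds[OF tail z] chain_bounds[OF QL, of z] by (auto simp: QR_def)
    qed
    have ne: "R \<noteq> []" "QL \<noteq> []" and ends: "last R = a" "hd QL = a"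
      using Cons.prems(1) QL by (auto simp: chain_def)
    have RQ: "chain \<delta> a' y (R @ QL)"
      using Cons.prems(1) chain_mono[OF QL h(1)] ne ends short_pos[OF assms(1)] by (simp add: chain_append)
    have prodRQ: "mprod \<mu> (R @ QL) = mprod \<mu> R * mprod \<mu> QL"
      using ne ends mu_diag[of a] a ay yb assms(7) by (simp add: mprod_append)
    have IH: "dist (mprod \<mu> R * mprod \<mu> QL * mprod \<mu> P) (mprod \<mu> R * mprod \<mu> QL * mprod \<mu> QR)
        \<le> real (length P - 1) * (K * K * ((1 + \<kappa>) * W h))"
      using Cons.IH[OF RQ tail QR sub] by (simp add: prodRQ)
    have mbR: "mult_bound K (mprod \<mu> R)"
      using Cons.prems(1) assms(6,7) ay yb by (intro K) auto
    have mbP: "mult_bound K (mprod \<mu> P)"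
      using chain_mono[OF tail h(1)] a ay assms(7) by (intro K[of y b]) auto
    have cell: "dist (\<mu> a y) (mprod \<mu> QL) \<le> (1 + \<kappa>) * W h"
    proof -
      have "dist (\<mu> a y) (mprod \<mu> QL) \<le> (1 + \<kappa>) * W (y - a)"
        using a ay yb h assms(7) by (intro short_mprod(1)[OF assms(1) _ _ _ QL]) auto
      also have "\<dots> \<le> (1 + \<kappa>) * W h"
        using ay h kappa by (intro mult_left_mono W_mono) auto
      finally show ?thesis .
    qed
    have "dist (mprod \<mu> R * (\<mu> a y * mprod \<mu> P)) (mprod \<mu> R * (mprod \<mu> QL * mprod \<mu> P))
        \<le> K * dist (\<mu> a y * mprod \<mu> P) (mprod \<mu> QL * mprod \<mu> P)"
      using mbR by (simp add: mult_bound_def)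
    also have "\<dots> \<le> K * (K * dist (\<mu> a y) (mprod \<mu> QL))"
      using mbP assms(4) by (intro mult_left_mono) (auto simp: mult_bound_def)
    also have "\<dots> \<le> K * (K * ((1 + \<kappa>) * W h))"
      using cell assms(4) by (intro mult_left_mono) auto
    finally have first: "dist (mprod \<mu> R * (\<mu> a y * mprod \<mu> P)) (mprod \<mu> R * (mprod \<mu> QL * mprod \<mu> P))
        \<le> K * K * ((1 + \<kappa>) * W h)" by (simp add: mult_ac)
    have len: "real (length (x # P) - 1) = 1 + real (length P - 1)" by (simp add: P)
    have prodP: "mprod \<mu> (x # P) = \<mu> a y * mprod \<mu> P" by (simp add: P x)
    show ?thesis
      using dist_triangle[of "mprod \<mu> R * (\<mu> a y * mprod \<mu> P)" "mprod \<mu> R * (mprod \<mu> QL * mprod \<mu> QR)"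
          "mprod \<mu> R * (mprod \<mu> QL * mprod \<mu> P)"] first IH
      unfolding len prodP prodQ by (simp add: algebra_simps)
  qed
qed

subsection \<open>Dyadic grids\<close>

text \<open>The grid belongs to \<open>[0,S]\<close> and is only clamped to \<open>[a,b]\<close>. Subdividing \<open>[a,b]\<close> itself would at
  first give multiplicativity at midpoints only.\<close>

definition grid :: "nat \<Rightarrow> real \<Rightarrow> real \<Rightarrow> real list" where
  "grid n a b = map (\<lambda>i. max a (min b (S * real i / 2 ^ n))) [0..<Suc (2 ^ n)]"

lemma chain_grid:
  assumes "0 \<le> a" "a \<le> b" "b \<le> S"
  shows "chain (S / 2 ^ n) a b (grid n a b)"
proof -
  let ?p = "\<lambda>i. max a (min b (S * real i / 2 ^ n))"
  have step: "?p i \<le> ?p (Suc i) \<and> ?p (Suc i) - ?p i \<le> S / 2 ^ n" for i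
  proof -
    have "S * real (Suc i) / 2 ^ n = S * real i / 2 ^ n + S / 2 ^ n" by (simp add: field_simps)
    moreover have "0 \<le> S / 2 ^ n" using S_nonneg by simp
    ultimately show ?thesis using assms by linarith
  qed
  have "successively (\<lambda>x y. x \<le> y \<and> y - x \<le> S / 2 ^ n) (map ?p [0..<k])" for k
  proof (induction k)
    case (Suc k)
    show ?case
    proof (cases k)
      case (Suc j)
      have "last (map ?p [0..<k]) = ?p j" by (simp add: Suc)
      then show ?thesis using Suc.IH step[of j] Suc
        by (auto simp: successively_append_iff)
    qed simp
  qed simp
  moreover have "hd (grid n a b) = a" "last (grid n a b) = b"
    using assms by (simp_all add: grid_def hd_map del: upt_Suc) (simp add: upt_Suc)
  ultimately show ?thesis by (simp add: chain_def grid_def del: upt_Suc)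
qed

lemma set_grid: "set (grid n a b) = (\<lambda>i. max a (min b (S * real i / 2 ^ n))) ` {..2 ^ n}"
  by (auto simp: grid_def simp del: upt_Suc)

lemma length_grid: "length (grid n a b) = Suc (2 ^ n)"
  by (simp add: grid_def)

lemma grid_subset:
  assumes "n \<le> m"
  shows "set (grid n a b) \<subseteq> set (grid m a b)"
proof -
  have pow: "(2::'b::comm_semiring_1) ^ m = 2 ^ n * 2 ^ (m - n)"
    using assms by (simp flip: power_add)
  have "max a (min b (S * real i / 2 ^ n)) \<in> set (grid m a b)" if "i \<le> 2 ^ n" for i
  proof -
    have "S * real i / 2 ^ n = S * real (i * 2 ^ (m - n)) / 2 ^ m" by (simp add: pow)
    moreover have "i * 2 ^ (m - n) \<le> 2 ^ m" using that by (simp add: pow)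
    ultimately show ?thesis unfolding set_grid by (metis (mono_tags, lifting) atMost_iff image_eqI)
  qed
  then show ?thesis unfolding set_grid[of n] by blast
qed

text \<open>A point of the grid to the left of \<open>c\<close> is clamped to \<open>[a,b]\<close> and to \<open>[a,c]\<close> in the same way, and a point
  to the right in the same way to \<open>[a,b]\<close> and to \<open>[c,b]\<close>.\<close>

lemma grid_join_subset:
  assumes "a \<le> c" "c \<le> b"
  shows "set (grid n a b) \<subseteq> set (grid n a c @ grid n c b)"
proof
  fix x assume "x \<in> set (grid n a b)"
  then obtain i where i: "i \<le> 2 ^ n" and x: "x = max a (min b (S * real i / 2 ^ n))"
    by (auto simp: set_grid)
  let ?t = "S * real i / 2 ^ n"
  have "x = max a (min c ?t) \<or> x = max c (min b ?t)"
    using assms unfolding x by (cases "?t \<le> c") auto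
  with i show "x \<in> set (grid n a c @ grid n c b)"
    unfolding set_append set_grid by blast
qed

lemma refinement_error:
  obtains \<delta> e where "short \<delta>" "e \<longlonglongrightarrow> 0"
    "\<And>n a b Q. S / 2 ^ n \<le> \<delta> \<Longrightarrow> 0 \<le> a \<Longrightarrow> b \<le> S \<Longrightarrow> chain (S / 2 ^ n) a b Q \<Longrightarrow>
      set (grid n a b) \<subseteq> set Q \<Longrightarrow> dist (mprod \<mu> (grid n a b)) (mprod \<mu> Q) \<le> e n"
proof -
  obtain \<delta> where \<delta>: "short \<delta>" using ex_short ..
  obtain K where K1: "1 \<le> K" and
    K: "\<And>a b xs. 0 \<le> a \<Longrightarrow> b \<le> S \<Longrightarrow> chain \<delta> a b xs \<Longrightarrow> mult_bound K (mprod \<mu> xs)"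
    using mult_bound_chain[OF \<delta>] by blast
  define e where "e n = real (2 ^ n) * (K * K * ((1 + \<kappa>) * W (S / 2 ^ n)))" for n
  have S: "S \<in> {0..S}" using S_nonneg by simp
  have "(\<lambda>n. K * K * (1 + \<kappa>) * (2 ^ n * W (S / 2 ^ n))) \<longlonglongrightarrow> K * K * (1 + \<kappa>) * 0"
    by (intro tendsto_mult_left W_tendsto_weak S)
  moreover have "e = (\<lambda>n. K * K * (1 + \<kappa>) * (2 ^ n * W (S / 2 ^ n)))"
    by (simp add: e_def fun_eq_iff)
  ultimately have "e \<longlonglongrightarrow> 0" by simp
  moreover have "dist (mprod \<mu> (grid n a b)) (mprod \<mu> Q) \<le> e n"
    if n: "S / 2 ^ n \<le> \<delta>" and ab: "0 \<le> a" "b \<le> S" and Q: "chain (S / 2 ^ n) a b Q"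
      and sub: "set (grid n a b) \<subseteq> set Q" for n a b Q
  proof -
    have "a \<le> b" using Q by (rule chain_le)
    have "dist (mprod \<mu> [a] * mprod \<mu> (grid n a b)) (mprod \<mu> [a] * mprod \<mu> Q)
        \<le> real (length (grid n a b) - 1) * (K * K * ((1 + \<kappa>) * W (S / 2 ^ n)))"
    proof (rule dist_refinement[OF \<delta> n half_mem[OF S] K1 K ab(1,2) _ _ Q sub])
      show "chain \<delta> a a [a]" by (simp add: chain_def)
      show "chain (S / 2 ^ n) a b (grid n a b)" using ab \<open>a \<le> b\<close> by (intro chain_grid)
    qed auto
    then show ?thesis by (simp add: length_grid e_def)
  qed
  ultimately show thesis using that \<delta> by blast
qed

lemma grid_refine_trans: "n \<le> m \<Longrightarrow> S / 2 ^ m \<le> S / 2 ^ n"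
  using S_nonneg by (intro divide_left_mono power_increasing) auto

lemma eventually_fine:
  assumes "0 < \<delta>"
  shows "\<forall>\<^sub>F n in sequentially. S / 2 ^ n \<le> \<delta>"
proof -
  have "(\<lambda>n. S * (1 / 2) ^ n) \<longlonglongrightarrow> S * 0"
    by (intro tendsto_mult_left LIMSEQ_power_zero) simp
  then have "(\<lambda>n. S / 2 ^ n) \<longlonglongrightarrow> 0" by (simp add: power_divide)
  from order_tendstoD(2)[OF this assms] show ?thesis
    by eventually_elim simp
qed

text \<open>The Lipschitz constant of multiplication by \<open>x n\<close> is at most \<open>N (x n)\<close>, which stays bounded as
  \<open>x n\<close> converges.\<close>

lemma mult_tendsto:
  fixes x y :: "nat \<Rightarrow> 'a"
  assumes "x \<longlonglongrightarrow> x0" "y \<longlonglongrightarrow> y0"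
  shows "(\<lambda>n. x n * y n) \<longlonglongrightarrow> x0 * y0"
proof -
  have "continuous_on UNIV N" using N_lip by (rule lipschitz_on_continuous_on)
  then have N: "(\<lambda>n. N (x n)) \<longlonglongrightarrow> N x0"
    using assms(1) by (auto intro: continuous_on_tendsto_compose)
  have "(\<lambda>n. N (x n) * dist (y n) y0 + N y0 * dist (x n) x0) \<longlonglongrightarrow> N x0 * 0 + N y0 * 0"
    using assms by (intro tendsto_add tendsto_mult N tendsto_const) (simp_all add: tendsto_dist_iff[symmetric])
  then have "(\<lambda>n. N (x n) * dist (y n) y0 + N y0 * dist (x n) x0) \<longlonglongrightarrow> 0" by simp
  from tendsto_sandwich[OF _ _ tendsto_const this]
  have "(\<lambda>n. dist (x n * y n) (x0 * y0)) \<longlonglongrightarrow> 0"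
    by (simp add: dist_mult)
  then show ?thesis by (rule tendsto_dist_iff[THEN iffD2])
qed

lemma ex_limit:
  obtains u where "\<And>a b. 0 \<le> a \<Longrightarrow> a \<le> b \<Longrightarrow> b \<le> S \<Longrightarrow> (\<lambda>n. mprod \<mu> (grid n a b)) \<longlonglongrightarrow> u a b"
    "\<And>a c b. 0 \<le> a \<Longrightarrow> a \<le> c \<Longrightarrow> c \<le> b \<Longrightarrow> b \<le> S \<Longrightarrow> u a b = u a c * u c b"
proof -
  obtain \<delta> e where \<delta>: "short \<delta>" and e: "e \<longlonglongrightarrow> 0" and
    err: "\<And>n a b Q. S / 2 ^ n \<le> \<delta> \<Longrightarrow> 0 \<le> a \<Longrightarrow> b \<le> S \<Longrightarrow> chain (S / 2 ^ n) a b Q \<Longrightarrow>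
      set (grid n a b) \<subseteq> set Q \<Longrightarrow> dist (mprod \<mu> (grid n a b)) (mprod \<mu> Q) \<le> e n"
    using refinement_error by blast
  note fine = eventually_fine[OF short_pos[OF \<delta>]]
  have conv: "convergent (\<lambda>n. mprod \<mu> (grid n a b))" if ab: "0 \<le> a" "a \<le> b" "b \<le> S" for a b
  proof -
    have "Cauchy (\<lambda>n. mprod \<mu> (grid n a b))"
      unfolding Cauchy_altdef2
    proof (intro allI impI)
      fix r :: real assume "0 < r"
      from eventually_conj[OF order_tendstoD(2)[OF e this] fine]
      obtain n where n: "e n < r" "S / 2 ^ n \<le> \<delta>" by (auto simp: eventually_sequentially)
      have "dist (mprod \<mu> (grid m a b)) (mprod \<mu> (grid n a b)) < r" if "n \<le> m" for m
      proof -
        have "dist (mprod \<mu> (grid n a b)) (mprod \<mu> (grid m a b)) \<le> e n"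
          using ab that by (intro err n chain_mono[OF chain_grid] grid_refine_trans grid_subset) auto
        with n show ?thesis by (simp add: dist_commute)
      qed
      then show "\<exists>n. \<forall>m\<ge>n. dist (mprod \<mu> (grid m a b)) (mprod \<mu> (grid n a b)) < r" by blast
    qed
    then show ?thesis by (simp add: Cauchy_convergent_iff)
  qed
  define u where "u a b = lim (\<lambda>n. mprod \<mu> (grid n a b))" for a b
  have u: "(\<lambda>n. mprod \<mu> (grid n a b)) \<longlonglongrightarrow> u a b" if "0 \<le> a" "a \<le> b" "b \<le> S" for a b
    unfolding u_def using conv[OF that] by (simp add: convergent_LIMSEQ_iff)
  moreover have "u a b = u a c * u c b" if acb: "0 \<le> a" "a \<le> c" "c \<le> b" "b \<le> S" for a c b
  proof -
    have c1: "chain (S / 2 ^ n) a c (grid n a c)" and c2: "chain (S / 2 ^ n) c b (grid n c b)" for n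
      using acb by (auto intro!: chain_grid)
    have join: "chain (S / 2 ^ n) a b (grid n a c @ grid n c b)"
      "mprod \<mu> (grid n a c @ grid n c b) = mprod \<mu> (grid n a c) * mprod \<mu> (grid n c b)" for n
      using c1[of n] c2[of n] mu_diag[of c] acb S_nonneg
      by (auto simp: chain_def chain_append mprod_append successively_append_iff)
    have "\<forall>\<^sub>F n in sequentially. dist (mprod \<mu> (grid n a b))
        (mprod \<mu> (grid n a c) * mprod \<mu> (grid n c b)) \<le> e n"
      using fine
    proof eventually_elim
      case (elim n)
      from err[OF elim _ _ join(1) grid_join_subset] acb show ?case by (simp add: join(2))
    qed
    then have "(\<lambda>n. dist (mprod \<mu> (grid n a b)) (mprod \<mu> (grid n a c) * mprod \<mu> (grid n c b))) \<longlonglongrightarrow> 0"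
      by (rule tendsto_sandwich[OF _ _ tendsto_const e, rotated]) simp
    moreover have "(\<lambda>n. dist (mprod \<mu> (grid n a b)) (mprod \<mu> (grid n a c) * mprod \<mu> (grid n c b)))
        \<longlonglongrightarrow> dist (u a b) (u a c * u c b)"
      using acb by (intro tendsto_dist mult_tendsto u) auto
    ultimately have "dist (u a b) (u a c * u c b) = 0"
      by (rule LIMSEQ_unique[symmetric])
    then show ?thesis by simp
  qed
  ultimately show thesis using that by blast
qed

text \<open>The constant valid up to length \<open>2\<^sup>k \<delta>\<close> yields one valid up to twice that length, since
  \<open>\<mu>(a,b)\<close> and \<open>\<mu>(a,m) \<mu>(m,b)\<close> differ by at most \<open>V(b - a)\<close> at the midpoint \<open>m\<close>. The argument stays
  with multiples of \<open>Vbar\<close>, because \<open>Vbar\<close> may vanish on an interval \<open>[0,t]\<close>, so that boundedness of the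
  distance would not suffice.\<close>

lemma ex_solution: "\<exists>u. solves S W \<mu> u"
proof -
  obtain u where lim: "\<And>a b. 0 \<le> a \<Longrightarrow> a \<le> b \<Longrightarrow> b \<le> S \<Longrightarrow> (\<lambda>n. mprod \<mu> (grid n a b)) \<longlonglongrightarrow> u a b"
    and mult: "\<And>a c b. 0 \<le> a \<Longrightarrow> a \<le> c \<Longrightarrow> c \<le> b \<Longrightarrow> b \<le> S \<Longrightarrow> u a b = u a c * u c b"
    using ex_limit by blast
  obtain \<delta> where \<delta>: "short \<delta>" using ex_short ..
  obtain B where B: "1 \<le> B" "\<And>a b. 0 \<le> a \<Longrightarrow> a \<le> b \<Longrightarrow> b \<le> S \<Longrightarrow> N (\<mu> a b) \<le> B"
    using mu_bounded by blast
  have S: "S \<in> {0..S}" using S_nonneg by simp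
  have main: "\<exists>C\<ge>0. \<forall>a b. 0 \<le> a \<and> a \<le> b \<and> b \<le> S \<and> b - a \<le> 2 ^ k * \<delta> \<longrightarrow>
      dist (\<mu> a b) (u a b) \<le> C * W (b - a)" for k
  proof (induction k)
    case 0
    have "dist (\<mu> a b) (u a b) \<le> (1 + \<kappa>) * W (b - a)" if ab: "0 \<le> a" "a \<le> b" "b \<le> S" "b - a \<le> \<delta>" for a b
    proof (rule Lim_bounded)
      show "(\<lambda>n. dist (\<mu> a b) (mprod \<mu> (grid n a b))) \<longlonglongrightarrow> dist (\<mu> a b) (u a b)"
        using ab by (intro tendsto_dist tendsto_const lim) auto
      show "\<forall>n\<ge>0. dist (\<mu> a b) (mprod \<mu> (grid n a b)) \<le> (1 + \<kappa>) * W (b - a)"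
        using short_mprod(1)[OF \<delta> _ _ _ chain_grid] ab by blast
    qed
    then show ?case using kappa by (intro exI[of _ "1 + \<kappa>"]) auto
  next
    case (Suc k)
    then obtain C where C: "0 \<le> C" and
      close: "\<And>a b. 0 \<le> a \<Longrightarrow> a \<le> b \<Longrightarrow> b \<le> S \<Longrightarrow> b - a \<le> 2 ^ k * \<delta> \<Longrightarrow> dist (\<mu> a b) (u a b) \<le> C * W (b - a)"
      by blast
    define C' where "C' = 1 + (B + (B + L * (C * W S))) * C"
    have CW: "0 \<le> C * W S" using C W_nonneg[OF S] by simp
    have C': "0 \<le> (B + (B + L * (C * W S))) * C" using B C CW L_nonneg by simp
    have "dist (\<mu> a b) (u a b) \<le> C' * W (b - a)"
      if ab: "0 \<le> a" "a \<le> b" "b \<le> S" "b - a \<le> 2 ^ Suc k * \<delta>" for a b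
    proof -
      define m where "m = (a + b) / 2"
      have m: "0 \<le> m" "a \<le> m" "m \<le> b" "m \<le> S" "m - a = (b - a) / 2" "b - m = (b - a) / 2"
        using ab by (auto simp: m_def field_simps)
      have t: "b - a \<in> {0..S}" using ab by auto
      have half: "(b - a) / 2 \<in> {0..S}" using half_mem[OF t, of 1] by simp
      have d1: "dist (\<mu> a m) (u a m) \<le> C * W ((b - a) / 2)"
        using close[of a m] ab m by simp
      have d2: "dist (\<mu> m b) (u m b) \<le> C * W ((b - a) / 2)"
        using close[of m b] ab m by simp
      have "C * W ((b - a) / 2) \<le> C * W S"
        using C half S by (intro mult_left_mono W_mono) auto
      with d2 have "L * dist (\<mu> m b) (u m b) \<le> L * (C * W S)"
        using L_nonneg by (intro mult_left_mono) auto
      then have Nu: "N (u m b) \<le> B + L * (C * W S)"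
        using N_le[of "u m b" "\<mu> m b"] B(2)[of m b] ab m by linarith
      have "dist (\<mu> a m * \<mu> m b) (u a m * u m b)
          \<le> B * dist (\<mu> m b) (u m b) + (B + L * (C * W S)) * dist (\<mu> a m) (u a m)"
        using ab m by (intro dist_mult B Nu) auto
      also have "\<dots> \<le> B * (C * W ((b - a) / 2)) + (B + L * (C * W S)) * (C * W ((b - a) / 2))"
        using B L_nonneg CW d1 d2 by (intro add_mono mult_left_mono) auto
      also have "\<dots> = (B + (B + L * (C * W S))) * C * W ((b - a) / 2)" by (simp add: algebra_simps)
      also have "\<dots> \<le> (B + (B + L * (C * W S))) * C * W (b - a)"
        using half t C' by (intro mult_left_mono W_mono) auto
      finally have "dist (\<mu> a m * \<mu> m b) (u a b) \<le> (B + (B + L * (C * W S))) * C * W (b - a)"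
        using mult[of a m b] ab m by simp
      moreover have "dist (\<mu> a b) (\<mu> a m * \<mu> m b) \<le> W (b - a)"
        using mu_almost[of a m b] V_le_W[OF t] ab m by simp
      ultimately show ?thesis
        using dist_triangle[of "\<mu> a b" "u a b" "\<mu> a m * \<mu> m b"] by (simp add: C'_def distrib_right)
    qed
    moreover have "0 \<le> C'" using C' by (simp add: C'_def)
    ultimately show ?case by blast
  qed
  obtain k where "S / \<delta> < 2 ^ k" using real_arch_pow[of 2 "S / \<delta>"] by auto
  then have k: "S \<le> 2 ^ k * \<delta>" using short_pos[OF \<delta>] by (simp add: field_simps)
  from main[of k] obtain C where "\<And>a b. 0 \<le> a \<Longrightarrow> a \<le> b \<Longrightarrow> b \<le> S \<Longrightarrow> b - a \<le> 2 ^ k * \<delta> \<Longrightarrow>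
      dist (\<mu> a b) (u a b) \<le> C * W (b - a)" by blast
  then have "dist (\<mu> a b) (u a b) \<le> C * W (b - a)" if "0 \<le> a" "a \<le> b" "b \<le> S" for a b
    using that k by simp
  with mult have "solves S W \<mu> u" unfolding solves_def by blast
  then show ?thesis by (intro exI[of _ u])
qed

text \<open>On short intervals both solutions have norm at most \<open>\<theta>/2\<close>, so passing to the two halves
  multiplies a bound on their distance by at most \<open>\<theta>\<close>. Multiplicativity extends the equality to long
  intervals.\<close>

lemma solution_unique:
  assumes "solves S W \<mu> u" "solves S W \<mu> v" "0 \<le> a" "a \<le> b" "b \<le> S"
  shows "u a b = v a b"
proof -
  obtain Cu where Cu: "\<And>a b. 0 \<le> a \<Longrightarrow> a \<le> b \<Longrightarrow> b \<le> S \<Longrightarrow> dist (\<mu> a b) (u a b) \<le> Cu * W (b - a)"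
    using assms(1) unfolding solves_def by blast
  obtain Cv where Cv: "\<And>a b. 0 \<le> a \<Longrightarrow> a \<le> b \<Longrightarrow> b \<le> S \<Longrightarrow> dist (\<mu> a b) (v a b) \<le> Cv * W (b - a)"
    using assms(2) unfolding solves_def by blast
  define C where "C = max 1 (max Cu Cv)"
  have C: "0 < C" by (simp add: C_def)
  have near: "dist (\<mu> a b) (u a b) \<le> C * W (b - a)" "dist (\<mu> a b) (v a b) \<le> C * W (b - a)"
    if "0 \<le> a" "a \<le> b" "b \<le> S" for a b
  proof -
    have "Cu * W (b - a) \<le> C * W (b - a)" "Cv * W (b - a) \<le> C * W (b - a)"
      using that W_nonneg[of "b - a"] by (auto intro!: mult_right_mono simp: C_def)
    then show "dist (\<mu> a b) (u a b) \<le> C * W (b - a)" "dist (\<mu> a b) (v a b) \<le> C * W (b - a)"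
      using Cu[OF that] Cv[OF that] by auto
  qed
  have mult: "w a b = w a c * w c b" if "w \<in> {u, v}" "0 \<le> a" "a \<le> c" "c \<le> b" "b \<le> S" for w a c b
    using assms(1,2) that unfolding solves_def by blast
  obtain \<delta> where \<delta>: "0 < \<delta>" and N_near: "\<And>a b z. 0 \<le> a \<Longrightarrow> a \<le> b \<Longrightarrow> b \<le> S \<Longrightarrow>
      b - a \<le> \<delta> \<Longrightarrow> dist (\<mu> a b) z \<le> C * W (b - a) \<Longrightarrow> N z \<le> \<theta> / 2"
    using N_close[of "\<theta> / 2" C] \<theta> C by auto
  have halve: "dist (u a b) (v a b) \<le> (2 * C) * (\<theta> ^ n * W ((b - a) / 2 ^ n))"
    if "0 \<le> a" "a \<le> b" "b \<le> S" "b - a \<le> \<delta>" for n a b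
    using that
  proof (induction n arbitrary: a b)
    case 0
    show ?case
      using near[OF 0(1-3)] dist_triangle3[of "u a b" "v a b" "\<mu> a b"] by simp
  next
    case (Suc n)
    define m where "m = (a + b) / 2"
    have m: "0 \<le> m" "a \<le> m" "m \<le> b" "m \<le> S" "m - a = (b - a) / 2" "b - m = (b - a) / 2"
      using Suc.prems by (auto simp: m_def field_simps)
    have s: "m - a \<le> \<delta>" "b - m \<le> \<delta>" using m Suc.prems by auto
    define D where "D = (2 * C) * (\<theta> ^ n * W ((b - a) / 2 ^ Suc n))"
    have "dist (u a m) (v a m) \<le> D" "dist (u m b) (v m b) \<le> D"
      using Suc.IH[of a m] Suc.IH[of m b] Suc.prems m s by (simp_all add: D_def)
    moreover have "N (u a m) \<le> \<theta> / 2"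
      using Suc.prems m s by (intro N_near[OF _ _ _ _ near(1)]) auto
    moreover have "N (v m b) \<le> \<theta> / 2"
      using Suc.prems m s by (intro N_near[OF _ _ _ _ near(2)]) auto
    ultimately have "dist (u a m * u m b) (v a m * v m b) \<le> \<theta> / 2 * D + \<theta> / 2 * D"
      using \<theta> by (intro order_trans[OF dist_mult[of _ "\<theta> / 2" _ "\<theta> / 2"]] add_mono mult_left_mono) auto
    then show ?case
      using mult[of u a m b] mult[of v a m b] Suc.prems m by (simp add: D_def algebra_simps)
  qed
  have main: "u a b = v a b" if "0 \<le> a" "a \<le> b" "b \<le> S" "b - a \<le> 2 ^ k * \<delta>" for k a b
    using that
  proof (induction k arbitrary: a b)
    case 0
    have "(\<lambda>n. (2 * C) * (\<theta> ^ n * W ((b - a) / 2 ^ n))) \<longlonglongrightarrow> (2 * C) * 0"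
      using 0 by (intro tendsto_mult_left W_tendsto) auto
    then have "dist (u a b) (v a b) \<le> 2 * C * 0"
      by (rule Lim_bounded2) (use halve 0 in auto)
    then show ?case by simp
  next
    case (Suc k)
    define m where "m = (a + b) / 2"
    have m: "0 \<le> m" "a \<le> m" "m \<le> b" "m \<le> S" "m - a = (b - a) / 2" "b - m = (b - a) / 2"
      using Suc.prems by (auto simp: m_def field_simps)
    then show ?case
      using Suc.IH[of a m] Suc.IH[of m b] Suc.prems mult[of u a m b] mult[of v a m b] by simp
  qed
  obtain k where "S / \<delta> < 2 ^ k" using real_arch_pow[of 2 "S / \<delta>"] by auto
  then have "S \<le> 2 ^ k * \<delta>" using \<delta> by (simp add: field_simps)
  with main[of a b k] assms(3-5) show ?thesis by simp
qed

end

theorem mainTheorem3: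
  fixes T :: ereal
    and V :: "real \<Rightarrow> real"
    and \<theta> :: real
    and N :: "'a :: {complete_space, monoid_mult} \<Rightarrow> real"
    and \<mu> :: "real \<Rightarrow> real \<Rightarrow> 'a"
  assumes "T > 0"
    and "\<And>x y z. dist (x * z) (y * z) \<le> N z * dist x y"
    and "\<And>x y z. dist (z * x) (z * y) \<le> N z * dist x y"
    and "\<exists>L. L-lipschitz_on UNIV N"
    and "N 1 = 1"
    and "strong_control_function T V"
    and "strong_exponent T V \<theta>"
    and "continuous_on (simplex_domain T) (\<lambda>(a, b). \<mu> a b)"
    and "\<And>a. a \<in> control_domain T \<Longrightarrow> \<mu> a a = 1"
    and "\<And>a c b. 0 \<le> a \<Longrightarrow> a \<le> c \<Longrightarrow> c \<le> b \<Longrightarrow> ereal b < T \<Longrightarrow>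
           dist (\<mu> a b) (\<mu> a c * \<mu> c b) \<le> V (b - a)"
  shows "\<exists>u. multiplicative T u \<and> close_to T (Vbar \<theta> V) \<mu> u \<and>
           (\<forall>v. multiplicative T v \<and> close_to T (Vbar \<theta> V) \<mu> v \<longrightarrow>
              (\<forall>(a, b)\<in>simplex_domain T. v a b = u a b))"
proof -
  obtain L where L: "L-lipschitz_on UNIV N" using assms(4) by blast
  have below: "ereal s < T" if "s \<le> S" "ereal S < T" for s S
    using that by (meson ereal_less_eq(3) le_less_trans)
  have sewing: "sewing S V \<theta> N L \<mu>" if S: "0 \<le> S" "ereal S < T" for S
  proof
    have dom: "{0..S} \<subseteq> control_domain T"
      using below S by (auto simp: control_domain_def)
    show "mult_bound (N z) z" for z using assms(2,3) by (simp add: mult_bound_def)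
    show "mono_on {0..S} V" "V 0 = 0"
      using assms(6) dom by (auto simp: strong_control_function_def control_function_def mono_on_subset)
    show "2 < \<theta>" "\<And>t. t \<in> {0..S} \<Longrightarrow> summable (\<lambda>n. \<theta> ^ n * V (t / 2 ^ n))"
      using assms(7) dom by (auto simp: strong_exponent_def)
    show "continuous_on {(a, b). 0 \<le> a \<and> a \<le> b \<and> b \<le> S} (\<lambda>(a, b). \<mu> a b)"
      using below S by (intro continuous_on_subset[OF assms(8)]) (auto simp: simplex_domain_def)
    show "\<mu> a a = 1" if "0 \<le> a" "a \<le> S" for a
      using that dom by (intro assms(9)) auto
    show "dist (\<mu> a b) (\<mu> a c * \<mu> c b) \<le> V (b - a)" if "0 \<le> a" "a \<le> c" "c \<le> b" "b \<le> S" for a c b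
      using that below S by (intro assms(10)) auto
  qed (use S L assms(5) in auto)
  let ?sol = "\<lambda>S. solves S (Vbar \<theta> V) \<mu>"
  have "\<exists>w. ?sol S w" if "0 \<le> S" "ereal S < T" for S
    using sewing.ex_solution[OF sewing[OF that]] .
  then obtain U where U: "\<And>S. 0 \<le> S \<Longrightarrow> ereal S < T \<Longrightarrow> ?sol S (U S)"
    by metis
  have agree: "w a b = w' a b" if "?sol b w" "?sol b w'" "0 \<le> a" "a \<le> b" "ereal b < T" for a b w w'
    using that by (intro sewing.solution_unique[OF sewing]) auto
  \<comment> \<open>The value at \<open>(a,b)\<close> is that of the solution on \<open>[0,S]\<close> for any \<open>S \<ge> b\<close>, by uniqueness.\<close>
  define u where "u a b = U b a b" for a b
  have u: "u a b = U S a b" if "0 \<le> a" "a \<le> b" "b \<le> S" "ereal S < T" for a b S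
    unfolding u_def using that below[OF that(3,4)]
    by (intro agree[of b] U solves_mono[OF U[of S]]) auto
  have "multiplicative T u"
    unfolding multiplicative_def
  proof (intro allI impI)
    fix a c b assume "0 \<le> a \<and> a \<le> c \<and> c \<le> b \<and> ereal b < T"
    moreover from this have "U b a b = U b a c * U b c b"
      using U[of b] by (auto simp: solves_def)
    ultimately show "u a b = u a c * u c b"
      using u[of a b b] u[of a c b] u[of c b b] by auto
  qed
  moreover have "close_to T (Vbar \<theta> V) \<mu> u"
    unfolding close_to_def
  proof (intro allI impI)
    fix S :: real assume S: "ereal S < T"
    show "\<exists>C. \<forall>a b. 0 \<le> a \<and> a \<le> b \<and> b \<le> S \<longrightarrow> dist (\<mu> a b) (u a b) \<le> C * Vbar \<theta> V (b - a)"
    proof (cases "0 \<le> S")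
      case True
      then obtain C where
        "\<And>a b. 0 \<le> a \<Longrightarrow> a \<le> b \<Longrightarrow> b \<le> S \<Longrightarrow> dist (\<mu> a b) (U S a b) \<le> C * Vbar \<theta> V (b - a)"
        using U[OF True S] unfolding solves_def by blast
      then show ?thesis using u[OF _ _ _ S] by (intro exI[of _ C]) auto
    qed auto
  qed
  moreover have "v a b = u a b" if v: "multiplicative T v" "close_to T (Vbar \<theta> V) \<mu> v"
    and ab: "(a, b) \<in> simplex_domain T" for v a b
  proof -
    have ab': "0 \<le> a" "a \<le> b" "ereal b < T" using ab by (auto simp: simplex_domain_def)
    have "?sol b v"
      using v below[OF _ ab'(3)] ab'(3) unfolding solves_def multiplicative_def close_to_def by blast
    then show ?thesis unfolding u_def using ab' U[of b] by (intro agree) auto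
  qed
  ultimately show ?thesis by blast
qed

end
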